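(* Let $\mathcal{W}=\{W_j\}_{j\in J}$ be an orthonormal $f$-system for $\mathcal{H}$. Then the following conditions are equivalent: (i) $\mathcal{W}$ is an orthonormal $f$-basis for $\mathcal{H}$. (ii) $f=\sum_{j\in J}\pi_{W_j}f$ for all $f\in\mathcal{H}$. (iii) $\|f\|^2=\sum_{j\in J}\|\pi_{W_j}f\|^2$ for all $f\in\mathcal{H}$. (iv) If $\pi_{W_j}f=0$ for all $j\in J$, then $f=0$.
   Context: $\mathcal{H}$ is a separable Hilbert space, $J$ is a countable (or finite) index set, and $\pi_W$ denotes the orthogonal projection onto a closed subspace $W$ of $\mathcal{H}$. A sequence $\{W_j\}_{j\in J}$ of closed subspaces of $\mathcal{H}$ is an orthonormal $f$-system for $\mathcal{H}$ if $\pi_{W_i}g_j=\delta_{ij}g_j$ for all $i,j\in J$ and $g_j\in W_j$. It is an orthonormal $f$-basis for $\mathcal{H}$ if it is an orthonormal $f$-system that is complete, i.e. $\mathcal{H}=\overline{\operatorname{span}}\{W_j\}_{j\in J}$. *)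

theory Defs
  imports "HOL-Analysis.Analysis"
begin

(* Scalar fields for Hilbert spaces. By the Gelfand-Mazur theorem every real_normed_field is,
   up to isometric isomorphism, the reals or the complex numbers; the axiom on scalar_cnj
   forces it to be the identity, respectively complex conjugation. This allows real and
   complex Hilbert spaces to be treated at once. *)
class hilbert_scalar = real_normed_field +
  fixes scalar_cnj :: "'a \<Rightarrow> 'a"
  assumes scalar_cnj_add: "scalar_cnj (x + y) = scalar_cnj x + scalar_cnj y"
    and scalar_cnj_mult_self: "scalar_cnj x * x = (norm x)\<^sup>2 *\<^sub>R 1"

instantiation real :: hilbert_scalar
begin
definition scalar_cnj_real :: "real \<Rightarrow> real" where "scalar_cnj_real x = x"
instance by standard (auto simp: scalar_cnj_real_def power2_eq_square)
end

instantiation complex :: hilbert_scalar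
begin
definition scalar_cnj_complex :: "complex \<Rightarrow> complex" where "scalar_cnj_complex = cnj"
instance
proof
  show "scalar_cnj (x + y) = scalar_cnj x + scalar_cnj y" for x y :: complex
    by (simp add: scalar_cnj_complex_def)
  show "scalar_cnj x * x = (norm x)\<^sup>2 *\<^sub>R 1" for x :: complex
    by (metis complex_norm_square mult.commute of_real_def scalar_cnj_complex_def)
qed
end

(* Linear in the first argument. The norm, topology and completeness are those of the type
   class banach; ip_self ties them to the inner product, whose positive definiteness is then
   inherited from the norm. *)
locale hilbert_space = vector_space smul
  for smul :: "'k::hilbert_scalar \<Rightarrow> 'a::banach \<Rightarrow> 'a" +
  fixes ip :: "'a \<Rightarrow> 'a \<Rightarrow> 'k"
  assumes smul_of_real: "smul (of_real r) x = r *\<^sub>R x"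
    and ip_add_left: "ip (x + y) z = ip x z + ip y z"
    and ip_smul_left: "ip (smul c x) y = c * ip x y"
    and ip_commute: "ip y x = scalar_cnj (ip x y)"
    and ip_self: "ip x x = of_real ((norm x)\<^sup>2)"

lemma real_hilbert_space:
  "hilbert_space scaleR (inner :: 'a::{real_inner, banach} \<Rightarrow> 'a \<Rightarrow> real)"
  by unfold_locales
     (auto simp: scalar_cnj_real_def inner_commute inner_add_left power2_norm_eq_inner algebra_simps)

lemma complex_hilbert_space:
  "hilbert_space (*) (\<lambda>x y :: complex. x * cnj y)"
  by unfold_locales
     (auto simp: scalar_cnj_complex_def scaleR_conv_of_real complex_norm_square algebra_simps
           simp flip: of_real_power)

definition closed_subspace :: "('k::field \<Rightarrow> 'a::banach \<Rightarrow> 'a) \<Rightarrow> 'a set \<Rightarrow> bool" where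
  "closed_subspace smul W \<longleftrightarrow> module.subspace smul W \<and> closed W"

(* Well defined when W is a closed subspace of a Hilbert space. *)
definition orth_proj :: "('a::banach \<Rightarrow> 'a \<Rightarrow> 'k::zero) \<Rightarrow> 'a set \<Rightarrow> 'a \<Rightarrow> 'a" where
  "orth_proj ip W f = (THE p. p \<in> W \<and> (\<forall>w\<in>W. ip (f - p) w = 0))"

definition orthonormal_f_system ::
  "('k::field \<Rightarrow> 'a::banach \<Rightarrow> 'a) \<Rightarrow> ('a \<Rightarrow> 'a \<Rightarrow> 'k) \<Rightarrow> 'j set \<Rightarrow> ('j \<Rightarrow> 'a set) \<Rightarrow> bool" where
  "orthonormal_f_system smul ip J W \<longleftrightarrow>
     (\<forall>j\<in>J. closed_subspace smul (W j)) \<and>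
     (\<forall>i\<in>J. \<forall>j\<in>J. \<forall>g\<in>W j. orth_proj ip (W i) g = (if i = j then g else 0))"

definition f_complete ::
  "('k::field \<Rightarrow> 'a::banach \<Rightarrow> 'a) \<Rightarrow> 'j set \<Rightarrow> ('j \<Rightarrow> 'a set) \<Rightarrow> bool" where
  "f_complete smul J W \<longleftrightarrow> closure (module.span smul (\<Union>j\<in>J. W j)) = UNIV"

definition orthonormal_f_basis ::
  "('k::field \<Rightarrow> 'a::banach \<Rightarrow> 'a) \<Rightarrow> ('a \<Rightarrow> 'a \<Rightarrow> 'k) \<Rightarrow> 'j set \<Rightarrow> ('j \<Rightarrow> 'a set) \<Rightarrow> bool" where
  "orthonormal_f_basis smul ip J W \<longleftrightarrow>
     orthonormal_f_system smul ip J W \<and> f_complete smul J W"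

end

theory Submission
  imports Defs
begin

text \<open>Orthogonal projections onto closed subspaces exist by norm minimisation. For a finite set F of
  indices the partial sum \<open>\<Sum>j\<in>F. P\<^sub>j f\<close> is the best approximation to f from the span of
  the \<open>W\<^sub>j\<close> with \<open>j \<in> F\<close>, and the squared distance is
  \<open>\<parallel>f\<parallel>\<^sup>2 - (\<Sum>j\<in>F. \<parallel>P\<^sub>j f\<parallel>\<^sup>2)\<close>. The identity makes the expansion and the
  Parseval equality equivalent, best approximation derives the expansion from density, and projecting
  onto the closure of the span shows that totality gives density.\<close>

section \<open>Conjugation on the scalar field\<close>

lemma scalar_cnj_zero [simp]: "scalar_cnj 0 = (0 :: 'k::hilbert_scalar)"
  using scalar_cnj_add[of "0::'k" 0] by simp

text \<open>At a nonzero real, \<open>scalar_cnj_mult_self\<close> has the form conj(r) * r = r * r,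
  and r cancels; at zero, additivity decides.\<close>

lemma scalar_cnj_of_real [simp]: "scalar_cnj (of_real r) = (of_real r :: 'k::hilbert_scalar)"
proof (cases "r = 0")
  case False
  have "scalar_cnj (of_real r) * (of_real r :: 'k) = of_real r * of_real r"
    using scalar_cnj_mult_self[of "of_real r :: 'k"]
    by (simp add: power2_eq_square flip: of_real_mult) (simp add: of_real_def)
  with False show ?thesis by simp
qed simp

context hilbert_space
begin

section \<open>Inner product and norm\<close>

lemma ip_add_right: "ip x (y + z) = ip x y + ip x z"
  using ip_commute[of x "y + z"] ip_commute[of x y] ip_commute[of x z]
  by (simp add: ip_add_left scalar_cnj_add)

lemma ip_zero_left [simp]: "ip 0 x = 0"
  using ip_add_left[of 0 0 x] by simp

lemma ip_zero_right [simp]: "ip x 0 = 0"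
  using ip_add_right[of x 0 0] by simp

lemma ip_diff_left: "ip (x - y) z = ip x z - ip y z"
  using ip_add_left[of "x - y" y z] by (simp add: algebra_simps)

lemma ip_diff_right: "ip x (y - z) = ip x y - ip x z"
  using ip_add_right[of x "y - z" z] by (simp add: algebra_simps)

lemma ip_sum_left: "ip (sum g F) z = (\<Sum>j\<in>F. ip (g j) z)"
  by (induction F rule: infinite_finite_induct) (auto simp: ip_add_left)

lemma ip_orthogonal_sym: "ip x y = 0 \<Longrightarrow> ip y x = 0"
  using ip_commute[of y x] by simp

lemma ip_self_eq_zero_iff: "ip x x = 0 \<longleftrightarrow> x = 0"
  by (simp add: ip_self)

text \<open>Pythagoras. \<open>ip_self\<close> ties the inner product to the norm inside the scalar
  field, so the identity is proved for embedded reals and pulled back by injectivity of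
  \<open>of_real\<close>.\<close>

lemma norm_add_orthogonal:
  assumes "ip x y = 0"
  shows "(norm (x + y))\<^sup>2 = (norm x)\<^sup>2 + (norm y)\<^sup>2"
proof -
  have "(of_real ((norm (x + y))\<^sup>2) :: 'k) = of_real ((norm x)\<^sup>2 + (norm y)\<^sup>2)"
    using assms ip_orthogonal_sym[OF assms] unfolding of_real_add ip_self[symmetric]
    by (simp add: ip_add_left ip_add_right)
  then show ?thesis by (simp only: of_real_eq_iff)
qed

lemma parallelogram_law:
  fixes x y :: 'a
  shows "(norm (x + y))\<^sup>2 + (norm (x - y))\<^sup>2 = 2 * (norm x)\<^sup>2 + 2 * (norm y)\<^sup>2"
proof -
  have "ip (x + y) (x + y) + ip (x - y) (x - y) = (ip x x + ip x x) + (ip y y + ip y y)"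
    by (simp add: ip_add_left ip_add_right ip_diff_left ip_diff_right)
  then show ?thesis
    unfolding ip_self of_real_add[symmetric] of_real_eq_iff by simp
qed

text \<open>The class axioms evaluate only products of the form conj(y) * y. The computation is
  arranged to produce one, with y equal to c times the squared norm of x.\<close>

lemma norm_smul: "norm (smul c x) = norm c * norm x"
proof (cases "x = 0")
  case False
  let ?s = "(norm x)\<^sup>2"
  have "of_real ((norm (smul c x))\<^sup>2) = c * ip x (smul c x)"
    by (simp add: ip_self[symmetric] ip_smul_left del: of_real_power)
  also have "ip x (smul c x) = scalar_cnj (c * of_real ?s)"
    by (subst ip_commute) (simp add: ip_smul_left ip_self)
  \<comment> \<open>Multiplying both sides by \<open>?s\<close> completes the product conj(y) *
    y.\<close>
  finally have "of_real ((norm (smul c x))\<^sup>2 * ?s)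
      = scalar_cnj (c * of_real ?s) * (c * of_real ?s)"
    by (simp add: mult_ac)
  also have "\<dots> = of_real ((norm c * ?s)\<^sup>2)"
    unfolding scalar_cnj_mult_self of_real_def[symmetric]
    by (simp only: norm_mult norm_of_real abs_power2 abs_norm_cancel)
  finally have "(norm (smul c x))\<^sup>2 * ?s = (norm c * ?s)\<^sup>2"
    by (simp only: of_real_eq_iff)
  then have "(norm (smul c x))\<^sup>2 = (norm c * norm x)\<^sup>2"
    using False by (simp add: power_mult_distrib power2_eq_square)
  then show ?thesis by (simp add: power2_eq_iff_nonneg)
qed simp

lemma bounded_linear_smul: "bounded_linear (smul c)"
proof (rule bounded_linear_intro[where K = "norm c"])
  show "smul c (r *\<^sub>R x) = r *\<^sub>R smul c x" for r x
    by (simp add: smul_of_real[symmetric] mult.commute)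
qed (simp_all add: norm_smul scale_right_distrib mult.commute)

section \<open>Closed subspaces and orthogonality\<close>

lemma subspace_scaleR:
  assumes "module.subspace smul V" "x \<in> V"
  shows "r *\<^sub>R x \<in> V"
  using assms subspace_scale[of V x "of_real r"] by (simp add: smul_of_real)

lemma closed_subspace_closure:
  assumes "module.subspace smul V"
  shows "closed_subspace smul (closure V)"
proof -
  have "0 \<in> closure V"
    using assms local.subspace_0 closure_subset by blast
  moreover have "x + y \<in> closure V" if "x \<in> closure V" "y \<in> closure V" for x y
  proof -
    from that obtain a b where
      "\<And>n. a n \<in> V" "a \<longlonglongrightarrow> x" "\<And>n. b n \<in> V" "b \<longlonglongrightarrow> y"
      unfolding closure_sequential by blast
    then show ?thesis
      unfolding closure_sequential using assms local.subspace_add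
      by (intro exI[of _ "\<lambda>n. a n + b n"]) (auto intro: tendsto_add)
  qed
  moreover have "smul c x \<in> closure V" if "x \<in> closure V" for c x
  proof -
    from that obtain a where "\<And>n. a n \<in> V" "a \<longlonglongrightarrow> x"
      unfolding closure_sequential by blast
    then show ?thesis
      unfolding closure_sequential using assms local.subspace_scale
      by (intro exI[of _ "\<lambda>n. smul c (a n)"])
         (auto intro: bounded_linear.tendsto[OF bounded_linear_smul])
  qed
  ultimately show ?thesis
    unfolding closed_subspace_def by (auto intro: local.subspaceI)
qed

text \<open>Scaling is checked in the first argument, where linearity is given, and carried over by
  symmetry of orthogonality.\<close>

lemma subspace_orthogonal: "module.subspace smul {w. ip x w = 0}"
proof (rule local.subspaceI)
  fix c w assume "w \<in> {w. ip x w = 0}"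
  then have "ip (smul c w) x = 0"
    by (simp add: ip_smul_left ip_orthogonal_sym)
  then show "smul c w \<in> {w. ip x w = 0}"
    by (simp add: ip_orthogonal_sym)
qed (auto simp: ip_add_right)

lemma orthogonal_span:
  assumes "\<And>w. w \<in> S \<Longrightarrow> ip x w = 0" "w \<in> module.span smul S"
  shows "ip x w = 0"
proof -
  have "module.span smul S \<subseteq> {w. ip x w = 0}"
    using assms(1) by (intro local.span_minimal subspace_orthogonal) auto
  then show ?thesis using assms(2) by auto
qed

section \<open>Existence and uniqueness of orthogonal projections\<close>

lemma closest_point_orthogonal:
  assumes V: "module.subspace smul V" and "p \<in> V"
    and closest: "\<And>w. w \<in> V \<Longrightarrow> norm (f - p) \<le> norm (f - w)"
    and "u \<in> V"
  shows "ip (f - p) u = 0"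
proof (rule ccontr)
  define x a where "x = f - p" and "a = ip x u"
  assume "ip (f - p) u \<noteq> 0"
  then have a: "a \<noteq> 0" by (simp add: a_def x_def)
  then have u: "u \<noteq> 0" by (auto simp: a_def)
  text \<open>Moving from p towards the component of x along u decreases the distance.\<close>
  define c where "c = of_real (inverse ((norm u)\<^sup>2)) * a"
  let ?v = "smul c u"
  have aa: "a * scalar_cnj a = of_real ((norm a)\<^sup>2)"
    using scalar_cnj_mult_self[of a] by (simp add: mult.commute of_real_def)
  have vx: "ip ?v x = of_real ((norm a)\<^sup>2 / (norm u)\<^sup>2)"
    using aa by (simp add: c_def ip_smul_left ip_commute[of u x] a_def[symmetric] mult.assoc
        divide_inverse mult.commute)
  have xv: "ip x ?v = of_real ((norm a)\<^sup>2 / (norm u)\<^sup>2)"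
    by (subst ip_commute, subst vx) (rule scalar_cnj_of_real)
  have nv: "(norm ?v)\<^sup>2 = (norm a)\<^sup>2 / (norm u)\<^sup>2"
    using u unfolding c_def norm_smul norm_mult norm_of_real
    by (simp add: field_simps power2_eq_square)
  \<comment> \<open>\<open>?v\<close> is the component of \<open>x\<close> along \<open>u\<close>,
    so by Pythagoras replacing \<open>p\<close> by \<open>p + ?v\<close> lowers the squared distance
    by the positive amount computed in \<open>nv\<close>.\<close>
  have "ip (x - ?v) ?v = 0"
    unfolding ip_diff_left xv ip_self nv by simp
  from norm_add_orthogonal[OF this]
  have "(norm x)\<^sup>2 = (norm (x - ?v))\<^sup>2 + (norm ?v)\<^sup>2" by simp
  moreover have "norm x \<le> norm (x - ?v)"
    using closest[of "p + ?v"] V \<open>p \<in> V\<close> \<open>u \<in> V\<close>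
    by (simp add: x_def local.subspace_add local.subspace_scale algebra_simps)
  then have "(norm x)\<^sup>2 \<le> (norm (x - ?v))\<^sup>2" by (simp add: power_mono)
  moreover have "(norm ?v)\<^sup>2 > 0" using a u by (simp add: nv)
  ultimately show False by linarith
qed

text \<open>A minimising sequence is Cauchy by the parallelogram law, and completeness and
  closedness put its limit in V.\<close>

lemma closest_point_exists:
  assumes V: "closed_subspace smul V"
  obtains p where "p \<in> V" "\<And>w. w \<in> V \<Longrightarrow> norm (f - p) \<le> norm (f - w)"
proof -
  have sub: "module.subspace smul V" and cl: "closed V"
    using V by (auto simp: closed_subspace_def)
  define D where "D = (INF w\<in>V. (norm (f - w))\<^sup>2)"
  have ne: "V \<noteq> {}" using local.subspace_0[OF sub] by blast
  have bdd: "bdd_below ((\<lambda>w. (norm (f - w))\<^sup>2) ` V)"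
    by (auto intro: bdd_belowI[of _ 0])
  have D: "D \<le> (norm (f - w))\<^sup>2" if "w \<in> V" for w
    unfolding D_def by (rule cINF_lower[OF bdd that])
  have "\<exists>w\<in>V. (norm (f - w))\<^sup>2 < D + inverse (real (Suc n))" for n
    using cINF_less_iff[OF ne bdd, of "D + inverse (real (Suc n))"] unfolding D_def[symmetric]
    by simp
  then obtain w where wV: "\<And>n. w n \<in> V"
    and w: "\<And>n. (norm (f - w n))\<^sup>2 < D + inverse (real (Suc n))"
    by metis
  \<comment> \<open>The midpoint of x and y lies in V, so its squared distance to f is at least
    \<open>D\<close>; the parallelogram law for f - x and f - y then bounds their difference by the
    two excesses over \<open>D\<close>.\<close>
  have dist: "(norm (x - y))\<^sup>2 \<le> 2 * ((norm (f - x))\<^sup>2 - D) + 2 * ((norm (f - y))\<^sup>2 - D)"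
    if "x \<in> V" "y \<in> V" for x y
  proof -
    have "(1/2) *\<^sub>R (x + y) \<in> V"
      using that sub by (intro subspace_scaleR local.subspace_add)
    note D[OF this]
    moreover have "(f - x) + (f - y) = 2 *\<^sub>R (f - (1/2) *\<^sub>R (x + y))"
      by (simp add: algebra_simps scaleR_2)
    then have "(norm ((f - x) + (f - y)))\<^sup>2 = 4 * (norm (f - (1/2) *\<^sub>R (x + y)))\<^sup>2"
      by (simp only: norm_scaleR power_mult_distrib) simp
    moreover have "norm ((f - x) - (f - y)) = norm (x - y)"
      by (simp add: norm_minus_commute)
    ultimately show ?thesis
      using parallelogram_law[of "f - x" "f - y"] by simp
  qed
  have "Cauchy w"
  proof (rule metric_CauchyI)
    fix e :: real assume e: "e > 0"
    \<comment> \<open>With both excesses below a quarter of the square of e, the factors 2 in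
      \<open>dist\<close> add up to exactly that square.\<close>
    then obtain N where N: "inverse (real (Suc N)) < e\<^sup>2 / 4"
      using reals_Archimedean[of "e\<^sup>2 / 4"] by auto
    have "dist (w m) (w n) < e" if "m \<ge> N" "n \<ge> N" for m n
    proof -
      have "inverse (real (Suc k)) \<le> inverse (real (Suc N))" if "k \<ge> N" for k
        using that by (intro le_imp_inverse_le) auto
      from this[OF that(1)] this[OF that(2)]
      have "(norm (f - w m))\<^sup>2 - D < e\<^sup>2 / 4" "(norm (f - w n))\<^sup>2 - D < e\<^sup>2 / 4"
        using w[of m] w[of n] N by linarith+
      then have "(norm (w m - w n))\<^sup>2 < e\<^sup>2"
        using dist[OF wV wV, of m n] by argo
      then show ?thesis
        using e by (simp add: dist_norm power2_less_imp_less)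
    qed
    then show "\<exists>M. \<forall>m\<ge>M. \<forall>n\<ge>M. dist (w m) (w n) < e" by blast
  qed
  then obtain p where p: "w \<longlonglongrightarrow> p"
    using Cauchy_convergent_iff convergent_def by blast
  have "p \<in> V" using closed_sequentially[OF cl wV p] .
  moreover have "(norm (f - p))\<^sup>2 \<le> D"
  proof (rule LIMSEQ_le)
    show "(\<lambda>n. (norm (f - w n))\<^sup>2) \<longlonglongrightarrow> (norm (f - p))\<^sup>2"
      by (intro tendsto_intros p)
    show "(\<lambda>n. D + inverse (real (Suc n))) \<longlonglongrightarrow> D"
      using tendsto_add[OF tendsto_const LIMSEQ_inverse_real_of_nat, of D] by simp
  qed (use w less_imp_le in blast)
  then have "norm (f - p) \<le> norm (f - v)" if "v \<in> V" for v
    using power2_le_imp_le[OF order_trans[OF _ D[OF that]]] by simp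
  ultimately show ?thesis using that by blast
qed

text \<open>Two candidates differ by a vector of V that is orthogonal to itself. This is also the
  way to compute a projection from a known candidate.\<close>

lemma orth_proj_unique:
  assumes V: "module.subspace smul V"
    and p: "p \<in> V" "\<And>w. w \<in> V \<Longrightarrow> ip (f - p) w = 0"
  shows "orth_proj ip V f = p"
  unfolding orth_proj_def
proof (rule the_equality)
  fix q assume q: "q \<in> V \<and> (\<forall>w\<in>V. ip (f - q) w = 0)"
  then have "q - p \<in> V" using p V by (simp add: local.subspace_diff)
  then have "ip (f - p) (q - p) = 0" "ip (f - q) (q - p) = 0" using p q by auto
  then have "ip (q - p) (q - p) = 0" by (simp add: ip_diff_left)
  then show "q = p" by (simp add: ip_self_eq_zero_iff)
qed (use p in auto)

text \<open>The closest point meets the defining condition of \<open>orth_proj\<close>, so the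
  definite description denotes.\<close>

lemma
  assumes V: "closed_subspace smul V"
  shows orth_proj_in: "orth_proj ip V f \<in> V"
    and orth_proj_orthogonal: "w \<in> V \<Longrightarrow> ip (f - orth_proj ip V f) w = 0"
proof -
  have sub: "module.subspace smul V" using V by (simp add: closed_subspace_def)
  obtain p where p: "p \<in> V" "\<And>w. w \<in> V \<Longrightarrow> norm (f - p) \<le> norm (f - w)"
    using closest_point_exists[OF V] by blast
  have orth: "ip (f - p) w = 0" if "w \<in> V" for w
    using closest_point_orthogonal[OF sub p that] .
  have "orth_proj ip V f = p" using orth_proj_unique[OF sub p(1) orth] .
  then show "orth_proj ip V f \<in> V" "w \<in> V \<Longrightarrow> ip (f - orth_proj ip V f) w = 0"
    using p orth by auto
qed

text \<open>Linear combinations are finite, so each vector of the span involves only finitely many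
  of the subspaces. This connects density of the span with finite partial sums.\<close>

lemma span_UN_finite:
  assumes "g \<in> module.span smul (\<Union>j\<in>J. W j)"
  obtains F where "finite F" "F \<subseteq> J" "g \<in> module.span smul (\<Union>j\<in>F. W j)"
proof -
  obtain T where T: "finite T" "T \<subseteq> (\<Union>j\<in>J. W j)" "g \<in> module.span smul T"
    using assms by (auto simp: local.span_explicit)
  from T(2) obtain k where k: "\<And>t. t \<in> T \<Longrightarrow> k t \<in> J \<and> t \<in> W (k t)"
    by (metis UN_E subsetD)
  have "finite (k ` T)" "k ` T \<subseteq> J" "T \<subseteq> (\<Union>j\<in>k ` T. W j)"
    using k T(1) by auto
  then show ?thesis using T(3) local.span_mono that by blast
qed

section \<open>Finite partial sums of an orthonormal f-system\<close>

context
  fixes J :: "'j set" and W :: "'j \<Rightarrow> 'a set"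
  assumes system: "orthonormal_f_system smul ip J W"
begin

abbreviation proj :: "'j \<Rightarrow> 'a \<Rightarrow> 'a" where
  "proj j \<equiv> orth_proj ip (W j)"

lemma system_closed_subspace: "j \<in> J \<Longrightarrow> closed_subspace smul (W j)"
  using system by (auto simp: orthonormal_f_system_def)

lemma system_subspace: "j \<in> J \<Longrightarrow> module.subspace smul (W j)"
  using system_closed_subspace by (auto simp: closed_subspace_def)

text \<open>Since \<open>proj i g\<close> vanishes, g is its own residual with respect to
  \<open>W i\<close>.\<close>

lemma system_orthogonal:
  assumes "i \<in> J" "j \<in> J" "i \<noteq> j" "g \<in> W j" "w \<in> W i"
  shows "ip g w = 0"
proof -
  have "proj i g = 0" using assms system by (auto simp: orthonormal_f_system_def)
  then show ?thesis
    using orth_proj_orthogonal[OF system_closed_subspace[OF assms(1)] assms(5), of g] by simp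
qed

text \<open>It suffices to test against w in a single \<open>W i\<close>: all other summands are
  orthogonal to w, and \<open>proj i f\<close> has the same inner product with w as f.\<close>

lemma residual_orthogonal:
  assumes F: "finite F" "F \<subseteq> J" and w: "w \<in> module.span smul (\<Union>j\<in>F. W j)"
  shows "ip (f - (\<Sum>j\<in>F. proj j f)) w = 0"
proof (rule orthogonal_span[OF _ w])
  fix w assume "w \<in> (\<Union>j\<in>F. W j)"
  then obtain i where i: "i \<in> F" "w \<in> W i" by blast
  have "ip (\<Sum>j\<in>F. proj j f) w = (\<Sum>j\<in>F. if j = i then ip (proj i f) w else 0)"
    unfolding ip_sum_left
  proof (rule sum.cong)
    fix j assume "j \<in> F"
    then show "ip (proj j f) w = (if j = i then ip (proj i f) w else 0)"
      using system_orthogonal[of i j "proj j f" w] orth_proj_in[OF system_closed_subspace, of j f] i F(2)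
      by auto
  qed simp
  also have "\<dots> = ip (proj i f) w" using F i by simp
  also have "\<dots> = ip f w"
    using orth_proj_orthogonal[OF system_closed_subspace i(2), of f] i F(2)
    by (auto simp: ip_diff_left)
  finally show "ip (f - (\<Sum>j\<in>F. proj j f)) w = 0" by (simp add: ip_diff_left)
qed

lemma partial_sum_in_span:
  assumes "F \<subseteq> J"
  shows "(\<Sum>j\<in>F. proj j f) \<in> module.span smul (\<Union>j\<in>F. W j)"
proof (rule local.span_sum)
  fix j assume "j \<in> F"
  then have "proj j f \<in> (\<Union>j\<in>F. W j)"
    using assms orth_proj_in[OF system_closed_subspace, of j f] by auto
  then show "proj j f \<in> module.span smul (\<Union>j\<in>F. W j)" by (rule local.span_base)
qed

text \<open>The partial sum and g both lie in the finite span, so f - g splits orthogonally into the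
  residual and a vector of that span.\<close>

lemma partial_sum_best_approximation:
  assumes F: "finite F" "F \<subseteq> J" and g: "g \<in> module.span smul (\<Union>j\<in>F. W j)"
  shows "norm (f - (\<Sum>j\<in>F. proj j f)) \<le> norm (f - g)"
proof -
  let ?s = "\<Sum>j\<in>F. proj j f"
  have "ip (f - ?s) (?s - g) = 0"
    using residual_orthogonal[OF F] partial_sum_in_span[OF F(2)] g
    by (simp add: local.span_diff)
  from norm_add_orthogonal[OF this]
  have "(norm (f - g))\<^sup>2 = (norm (f - ?s))\<^sup>2 + (norm (?s - g))\<^sup>2" by simp
  then show ?thesis by (metis le_add_same_cancel1 norm_ge_zero power2_le_imp_le zero_le_power2)
qed

lemma norm_partial_sum:
  assumes "finite F" "F \<subseteq> J"
  shows "(norm (\<Sum>j\<in>F. proj j f))\<^sup>2 = (\<Sum>j\<in>F. (norm (proj j f))\<^sup>2)"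
  using assms
proof (induction F rule: finite_induct)
  case (insert i F)
  have "ip (proj j f) (proj i f) = 0" if "j \<in> F" for j
    using system_orthogonal[of i j "proj j f" "proj i f"] that insert
      orth_proj_in[OF system_closed_subspace, of i f] orth_proj_in[OF system_closed_subspace, of j f]
    by auto
  then have "ip (\<Sum>j\<in>F. proj j f) (proj i f) = 0" by (simp add: ip_sum_left)
  from norm_add_orthogonal[OF ip_orthogonal_sym[OF this]] insert show ?case by simp
qed simp

text \<open>The residual is orthogonal to the partial sum itself, so Pythagoras applies to their sum
  f.\<close>

lemma norm_residual:
  assumes F: "finite F" "F \<subseteq> J"
  shows "(norm (f - (\<Sum>j\<in>F. proj j f)))\<^sup>2 = (norm f)\<^sup>2 - (\<Sum>j\<in>F. (norm (proj j f))\<^sup>2)"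
  using norm_add_orthogonal[OF residual_orthogonal[OF F partial_sum_in_span[OF F(2)]], of f f]
  by (simp add: norm_partial_sum[OF F])

section \<open>Density, expansion, Parseval equality and totality\<close>

lemma complete_imp_expansion:
  assumes complete: "f_complete smul J W"
  shows "((\<lambda>j. proj j f) has_sum f) J"
  unfolding has_sum_def
proof (rule tendstoI)
  fix e :: real assume "e > 0"
  have "f \<in> closure (module.span smul (\<Union>j\<in>J. W j))"
    using complete by (simp add: f_complete_def)
  with \<open>e > 0\<close> obtain g where g: "g \<in> module.span smul (\<Union>j\<in>J. W j)" "dist g f < e"
    unfolding closure_approachable by blast
  obtain F where F: "finite F" "F \<subseteq> J" "g \<in> module.span smul (\<Union>j\<in>F. W j)"
    using span_UN_finite[OF g(1)] .
  \<comment> \<open>A larger index set has a larger span, so g still competes with the partial sum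
    over G; the bound thus holds along the whole net of finite subsets.\<close>
  have "dist (\<Sum>j\<in>G. proj j f) f < e" if G: "finite G" "F \<subseteq> G" "G \<subseteq> J" for G
  proof -
    have "g \<in> module.span smul (\<Union>j\<in>G. W j)"
      using F(3) local.span_mono[of "\<Union>j\<in>F. W j" "\<Union>j\<in>G. W j"] G(2) by blast
    from partial_sum_best_approximation[OF G(1,3) this, of f] g(2)
    show ?thesis by (simp add: dist_norm norm_minus_commute)
  qed
  then show "\<forall>\<^sub>F G in finite_subsets_at_top J. dist (\<Sum>j\<in>G. proj j f) f < e"
    unfolding eventually_finite_subsets_at_top using F by blast
qed

text \<open>The equivalence holds for each f separately: both sides say that the norms of the
  residuals tend to 0.\<close>

lemma expansion_iff_parseval:
  "((\<lambda>j. proj j f) has_sum f) J \<longleftrightarrow>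
   ((\<lambda>j. (norm (proj j f))\<^sup>2) has_sum (norm f)\<^sup>2) J"
proof -
  let ?A = "finite_subsets_at_top J"
  have "((\<lambda>j. proj j f) has_sum f) J \<longleftrightarrow>
      ((\<lambda>F. norm (f - (\<Sum>j\<in>F. proj j f))) \<longlongrightarrow> 0) ?A"
    unfolding has_sum_def
    by (subst tendsto_dist_iff) (simp add: dist_norm norm_minus_commute)
  also have "\<dots> \<longleftrightarrow> ((\<lambda>F. (norm (f - (\<Sum>j\<in>F. proj j f)))\<^sup>2) \<longlongrightarrow> 0) ?A"
  proof
    assume "((\<lambda>F. norm (f - (\<Sum>j\<in>F. proj j f))) \<longlongrightarrow> 0) ?A"
    from tendsto_power[OF this, of 2]
    show "((\<lambda>F. (norm (f - (\<Sum>j\<in>F. proj j f)))\<^sup>2) \<longlongrightarrow> 0) ?A" by simp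
  next
    assume "((\<lambda>F. (norm (f - (\<Sum>j\<in>F. proj j f)))\<^sup>2) \<longlongrightarrow> 0) ?A"
    from tendsto_real_sqrt[OF this]
    show "((\<lambda>F. norm (f - (\<Sum>j\<in>F. proj j f))) \<longlongrightarrow> 0) ?A" by simp
  qed
  \<comment> \<open>The filter contains only finite subsets of J eventually, which is where
    \<open>norm_residual\<close> applies.\<close>
  also have "\<dots> \<longleftrightarrow> ((\<lambda>F. (norm f)\<^sup>2 - (\<Sum>j\<in>F. (norm (proj j f))\<^sup>2)) \<longlongrightarrow> 0) ?A"
    by (intro filterlim_cong refl)
       (auto simp: norm_residual intro: eventually_finite_subsets_at_top_weakI)
  also have "\<dots> \<longleftrightarrow> ((\<lambda>j. (norm (proj j f))\<^sup>2) has_sum (norm f)\<^sup>2) J"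
    unfolding has_sum_def
    by (subst tendsto_dist_iff[of _ "(norm f)\<^sup>2"], subst tendsto_rabs_zero_iff[symmetric])
       (simp add: dist_real_def abs_minus_commute)
  finally show ?thesis .
qed

lemma total_imp_complete:
  assumes total: "\<And>f. (\<forall>j\<in>J. proj j f = 0) \<Longrightarrow> f = 0"
  shows "f_complete smul J W"
proof -
  let ?V = "closure (module.span smul (\<Union>j\<in>J. W j))"
  have V: "closed_subspace smul ?V"
    by (intro closed_subspace_closure local.subspace_span)
  have "f \<in> ?V" for f
  proof -
    let ?p = "orth_proj ip ?V f"
    \<comment> \<open>The residual f - \<open>?p\<close> is orthogonal to the closed span, hence to
      each \<open>W j\<close>, so 0 satisfies the characterisation of its projection.\<close>
    have "proj j (f - ?p) = 0" if "j \<in> J" for j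
    proof (rule orth_proj_unique[OF system_subspace[OF that]])
      show "0 \<in> W j" using system_subspace[OF that] by (rule local.subspace_0)
      fix w assume "w \<in> W j"
      then have "w \<in> ?V"
        using that closure_subset local.span_base[of w "\<Union>j\<in>J. W j"] by blast
      then show "ip (f - ?p - 0) w = 0"
        using orth_proj_orthogonal[OF V] by simp
    qed
    then have "f - ?p = 0" using total by blast
    then show ?thesis using orth_proj_in[OF V, of f] by simp
  qed
  then show ?thesis by (auto simp: f_complete_def)
qed

end

end

theorem theorem3p6:
  fixes smul :: "'k::hilbert_scalar \<Rightarrow> 'a::banach \<Rightarrow> 'a"
    and ip :: "'a \<Rightarrow> 'a \<Rightarrow> 'k"
    and J :: "'j set"
    and W :: "'j \<Rightarrow> 'a set"
  assumes "hilbert_space smul ip"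
    and "separable_space (euclidean :: 'a topology)"
    and "countable J"
    and "orthonormal_f_system smul ip J W"
  shows "(orthonormal_f_basis smul ip J W \<longleftrightarrow>
            (\<forall>f. ((\<lambda>j. orth_proj ip (W j) f) has_sum f) J)) \<and>
         (orthonormal_f_basis smul ip J W \<longleftrightarrow>
            (\<forall>f. ((\<lambda>j. (norm (orth_proj ip (W j) f))\<^sup>2) has_sum (norm f)\<^sup>2) J)) \<and>
         (orthonormal_f_basis smul ip J W \<longleftrightarrow>
            (\<forall>f. (\<forall>j\<in>J. orth_proj ip (W j) f = 0) \<longrightarrow> f = 0))"
proof -
  interpret hilbert_space smul ip by fact
  note sys = assms(4)
  have basis: "orthonormal_f_basis smul ip J W \<longleftrightarrow> f_complete smul J W"
    using sys by (simp add: orthonormal_f_basis_def)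
  have parseval: "(\<forall>f. ((\<lambda>j. orth_proj ip (W j) f) has_sum f) J) \<longleftrightarrow>
      (\<forall>f. ((\<lambda>j. (norm (orth_proj ip (W j) f))\<^sup>2) has_sum (norm f)\<^sup>2) J)"
    using expansion_iff_parseval[OF sys] by blast
  have total: "f = 0"
    if "\<forall>f. ((\<lambda>j. orth_proj ip (W j) f) has_sum f) J" "\<forall>j\<in>J. orth_proj ip (W j) f = 0" for f
  proof -
    \<comment> \<open>The expansion of such an f has only zero terms, so its sum is both 0 and
      f.\<close>
    have "((\<lambda>j. orth_proj ip (W j) f) has_sum 0) J"
      using that(2) by (intro has_sum_0) auto
    then show ?thesis using that(1) has_sum_unique by blast
  qed
  \<comment> \<open>The cycle is completeness, expansion, totality, completeness; Parseval joins it
    through its equivalence with the expansion.\<close>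
  show ?thesis
    unfolding basis
    using complete_imp_expansion[OF sys] total_imp_complete[OF sys] parseval total by blast
qed

end
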